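(* Let $R=T/I$ be the ring defined in the context. Then $R$ has no irreducible elements (atoms). In particular, $R$ is not atomic.
   Context: Construction of $R$. Let $p$ be a prime and let $\mathbb{F}$ be a perfect field of characteristic $p$. Let $x_1,x_2,\ldots,x_n,\ldots$ be countably infinitely many indeterminates and let $T=\mathbb{F}[x_1^{\alpha_1},x_2^{\alpha_2},\ldots,x_n^{\alpha_n},\ldots]$, where each exponent $\alpha_i$ ranges over all non-negative rational numbers; that is, $T$ is the monoid algebra over $\mathbb{F}$ of the additive monoid of finitely supported sequences of non-negative rationals, and its monomials are the products $\prod_i x_i^{\beta_i}$ with $\beta_i\in\mathbb{Q}_{\geq 0}$ and $\beta_i=0$ for all but finitely many $i$. Let $I$ be the ideal of $T$ generated by all monomials $\prod_i x_i^{\beta_i}$ with $\sum_i\beta_i>1$. Set $R=T/I$. Definitions. Let $S$ be a commutative ring with identity. A nonunit $a\in S$ is an atom (irreducible) if whenever $a=bc$ with $b,c\in S$, then $(a)=(b)$ or $(a)=(c)$ as ideals. The ring $S$ is atomic if every nonzero nonunit of $S$ is a finite product of atoms. *)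

theory Defs
  imports "HOL-Library.Poly_Mapping" "HOL-Algebra.Algebra" "HOL-Algebra.Algebraic_Closure_Type"
begin

section \<open>Perfect fields\<close>

definition perfect_field :: "'f::field itself \<Rightarrow> bool" where
  "perfect_field _ \<longleftrightarrow>
     CHAR('f) = 0 \<or> (\<forall>a::'f. \<exists>b. a = b ^ CHAR('f))"


section \<open>Atoms and atomic rings\<close>

text \<open>
  This is not \<^const>\<open>Divisibility.irreducible\<close> (nor \<^const>\<open>ring_irreducible\<close>): in rings with
  zero divisors the notions of irreducibility differ.
\<close>

definition atom :: "('a, 'm) ring_scheme \<Rightarrow> 'a \<Rightarrow> bool" where
  "atom S a \<longleftrightarrow> a \<in> carrier S \<and> a \<notin> Units S \<and>
     (\<forall>b\<in>carrier S. \<forall>c\<in>carrier S. a = b \<otimes>\<^bsub>S\<^esub> c \<longrightarrow>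
        PIdl\<^bsub>S\<^esub> a = PIdl\<^bsub>S\<^esub> b \<or> PIdl\<^bsub>S\<^esub> a = PIdl\<^bsub>S\<^esub> c)"

definition atomic_ring :: "('a, 'm) ring_scheme \<Rightarrow> bool" where
  "atomic_ring S \<longleftrightarrow>
     (\<forall>a\<in>carrier S. a \<noteq> \<zero>\<^bsub>S\<^esub> \<and> a \<notin> Units S \<longrightarrow>
        (\<exists>as. (\<forall>x\<in>set as. atom S x) \<and> a = foldr (\<otimes>\<^bsub>S\<^esub>) as \<one>\<^bsub>S\<^esub>))"


section \<open>The ring $R = T/I$\<close>

text \<open>
  An exponent is a finitely supported sequence of rationals, with index \<open>i\<close> standing for
  the indeterminate \<open>x\<^sub>i\<^sub>+\<^sub>1\<close>.  Multiplication on \<open>(nat \<Rightarrow>\<^sub>0 rat) \<Rightarrow>\<^sub>0 'f\<close> is convolution, so this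
  type is the monoid algebra of all such sequences, and \<open>T\<close> is its subring of elements supported on
  the submonoid of non-negative exponents, which is the monoid algebra of that submonoid.
\<close>

definition nonneg_exps :: "(nat \<Rightarrow>\<^sub>0 rat) set" where
  "nonneg_exps = {\<beta>. \<forall>i. Poly_Mapping.lookup \<beta> i \<ge> 0}"

definition T_ring :: "((nat \<Rightarrow>\<^sub>0 rat) \<Rightarrow>\<^sub>0 'f::field) ring" where
  "T_ring = ring_of_type_algebra\<lparr>carrier := {f. Poly_Mapping.keys f \<subseteq> nonneg_exps}\<rparr>"

definition total_deg :: "(nat \<Rightarrow>\<^sub>0 rat) \<Rightarrow> rat" where
  "total_deg \<beta> = (\<Sum>i\<in>Poly_Mapping.keys \<beta>. Poly_Mapping.lookup \<beta> i)"

definition I_ideal :: "((nat \<Rightarrow>\<^sub>0 rat) \<Rightarrow>\<^sub>0 'f::field) set" where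
  "I_ideal = Idl\<^bsub>T_ring\<^esub> {Poly_Mapping.single \<beta> 1 | \<beta>. \<beta> \<in> nonneg_exps \<and> total_deg \<beta> > 1}"

definition R_ring :: "((nat \<Rightarrow>\<^sub>0 rat) \<Rightarrow>\<^sub>0 'f::field) set ring" where
  "R_ring = T_ring Quot I_ideal"

lemma cring_T_ring: "cring (T_ring :: ((nat \<Rightarrow>\<^sub>0 rat) \<Rightarrow>\<^sub>0 'f::field) ring)"
proof -
  let ?A = "ring_of_type_algebra :: ((nat \<Rightarrow>\<^sub>0 rat) \<Rightarrow>\<^sub>0 'f) ring"
  let ?H = "{f :: (nat \<Rightarrow>\<^sub>0 rat) \<Rightarrow>\<^sub>0 'f. Poly_Mapping.keys f \<subseteq> nonneg_exps}"
  interpret A: cring ?A by (rule cring_from_type_algebra)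
  have minus: "\<ominus>\<^bsub>?A\<^esub> f = - f" for f
    by (rule A.minus_equality) (auto simp: ring_of_type_algebra_def)
  have "subring ?H ?A"
  proof (rule A.subringI)
    fix f g assume "f \<in> ?H" "g \<in> ?H"
    then have fg: "Poly_Mapping.keys f \<subseteq> nonneg_exps" "Poly_Mapping.keys g \<subseteq> nonneg_exps" by auto
    have "Poly_Mapping.keys (f * g) \<subseteq> {a + b |a b. a \<in> Poly_Mapping.keys f \<and> b \<in> Poly_Mapping.keys g}" by (rule keys_mult)
    also have "\<dots> \<subseteq> nonneg_exps"
      using fg by (fastforce simp: nonneg_exps_def lookup_add subset_eq)
    finally show "f \<otimes>\<^bsub>?A\<^esub> g \<in> ?H" by (simp add: ring_of_type_algebra_def)
    have "Poly_Mapping.keys (f + g) \<subseteq> Poly_Mapping.keys f \<union> Poly_Mapping.keys g" by (rule keys_add)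
    with fg show "f \<oplus>\<^bsub>?A\<^esub> g \<in> ?H" by (auto simp: ring_of_type_algebra_def)
  next
    fix f assume "f \<in> ?H"
    moreover have "Poly_Mapping.keys (- f) = Poly_Mapping.keys f" by (auto simp: in_keys_iff)
    ultimately show "\<ominus>\<^bsub>?A\<^esub> f \<in> ?H" by (simp add: minus)
  qed (auto simp: ring_of_type_algebra_def nonneg_exps_def)
  then have "subcring ?H ?A"
    by (intro A.subcringI) (auto simp: ring_of_type_algebra_def mult.commute)
  then show ?thesis
    using A.subcring_iff[of ?H] by (simp add: T_ring_def ring_of_type_algebra_def)
qed

lemma ideal_I_ideal: "ideal (I_ideal :: ((nat \<Rightarrow>\<^sub>0 rat) \<Rightarrow>\<^sub>0 'f::field) set) T_ring"
proof -
  interpret T: cring "T_ring :: ((nat \<Rightarrow>\<^sub>0 rat) \<Rightarrow>\<^sub>0 'f) ring" by (rule cring_T_ring)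
  show ?thesis unfolding I_ideal_def
    by (rule T.genideal_ideal) (auto simp: T_ring_def)
qed

lemma cring_R_ring: "cring (R_ring :: ((nat \<Rightarrow>\<^sub>0 rat) \<Rightarrow>\<^sub>0 'f::field) set ring)"
  unfolding R_ring_def by (rule ideal.quotient_is_cring[OF ideal_I_ideal cring_T_ring])

end

theory Submission
  imports Defs
begin

text \<open>
  Two properties of \<open>R\<close> exclude atoms.  First, \<open>R\<close> is closed under \<open>p\<close>-th roots: the exponents can be
  divided by \<open>p\<close>, the coefficients have \<open>p\<close>-th roots because the field is perfect, and the Frobenius
  map glues the roots of the terms together (\<open>T_ring_pth_root\<close>).  Secondly, every nonunit of \<open>R\<close>
  is nilpotent: a high Frobenius power multiplies all positive degrees by \<open>p\<^sup>k\<close>, so modulo \<open>I\<close> only the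
  constant term survives, which is a unit or zero (\<open>nonunit_nilpotent_R_ring\<close>).

  So a nonzero nonunit is \<open>a = g\<^sup>p = g \<sqdot> g\<^sup>p\<^sup>-\<^sup>1\<close> with \<open>g\<close> nilpotent.  If \<open>a\<close> generated the same
  ideal as one of the factors \<open>x\<close>, then \<open>x\<close> would be a multiple of itself by a nilpotent element, hence
  zero, and so would \<open>a\<close> (\<open>proper_power_not_atom\<close>).  The element \<open>0\<close> is a nonunit as well, so the
  definition of an atom applies to it; it is the square of the nonzero class of \<open>x\<^sub>1\<^sup>2\<^sup>/\<^sup>3\<close>.
  The same class is a nonzero nonunit, and with no atoms available only the empty product, \<open>1\<close>,
  is a product of atoms.
\<close>

section \<open>Rings with roots and nilpotent nonunits\<close>

context cring
begin

text \<open>Iterating \<open>x = x y\<close> gives \<open>x = x y\<^sup>n\<close> for every \<open>n\<close>.\<close>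

lemma eq_zero_if_eq_mult_nilpotent:
  assumes "x \<in> carrier R" "y \<in> carrier R" "x = x \<otimes> y" "y [^] (n::nat) = \<zero>"
  shows "x = \<zero>"
proof -
  have "x = x \<otimes> y [^] k" for k :: nat
  proof (induction k)
    case (Suc k)
    have "x = (x \<otimes> y [^] k) \<otimes> y" using Suc assms(3) by simp
    then show ?case using assms(1,2) by (simp add: m_assoc)
  qed (use assms in simp)
  from this[of n] assms show ?thesis by simp
qed

lemma eq_zero_if_PIdl_mult_nilpotent:
  assumes "x \<in> carrier R" "y \<in> carrier R" "PIdl (x \<otimes> y) = PIdl x" "y [^] (n::nat) = \<zero>"
  shows "x = \<zero>"
proof -
  have "x \<in> PIdl (x \<otimes> y)" using assms cgenideal_self by simp
  then obtain h where h: "h \<in> carrier R" "x = h \<otimes> (x \<otimes> y)" by (auto simp: cgenideal_def)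
  have "x = x \<otimes> (h \<otimes> y)" using h assms by (metis m_lcomm)
  moreover have "(h \<otimes> y) [^] n = \<zero>" using h assms by (simp add: nat_pow_distrib)
  ultimately show ?thesis using h assms by (metis eq_zero_if_eq_mult_nilpotent m_closed)
qed

text \<open>
  The factorization \<open>g\<^sup>p = g \<sqdot> g\<^sup>p\<^sup>-\<^sup>1\<close> has nilpotent factors because \<open>p \<ge> 2\<close>, so neither of
  them generates the same ideal as \<open>g\<^sup>p\<close>, unless \<open>g\<^sup>p\<close> vanishes.
\<close>

lemma proper_power_not_atom:
  assumes g: "g \<in> carrier R" and "(p::nat) \<ge> 2"
    and nil: "g [^] (n::nat) = \<zero>" and nz: "g [^] p \<noteq> \<zero>"
  shows "\<not> atom R (g [^] p)"
proof
  assume "atom R (g [^] p)"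
  obtain m where p: "p = Suc (Suc m)" using \<open>p \<ge> 2\<close> by (metis One_nat_def Suc_1 Suc_le_D Suc_le_mono)
  have eq: "g [^] p = g \<otimes> g [^] Suc m" "g [^] p = g [^] Suc m \<otimes> g"
    using g p by (auto simp: m_comm)
  have nz': "g \<noteq> \<zero>" "g [^] Suc m \<noteq> \<zero>"
    using nz g eq by auto
  have "(g [^] Suc m) [^] n = (g [^] n) [^] Suc m" using g by (simp only: nat_pow_pow mult.commute)
  then have nil': "(g [^] Suc m) [^] n = \<zero>" using nil g by simp
  have "PIdl (g [^] p) = PIdl g \<or> PIdl (g [^] p) = PIdl (g [^] Suc m)"
    using \<open>atom R (g [^] p)\<close> eq(1) g unfolding atom_def by (metis nat_pow_closed)
  then show False
  proof
    assume "PIdl (g [^] p) = PIdl g"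
    then show False
      using eq_zero_if_PIdl_mult_nilpotent[of g "g [^] Suc m" n] nz' nil' eq g by auto
  next
    assume "PIdl (g [^] p) = PIdl (g [^] Suc m)"
    then show False
      using eq_zero_if_PIdl_mult_nilpotent[of "g [^] Suc m" g n] nz' nil eq g by auto
  qed
qed

lemma zero_not_atom:
  assumes "u \<in> carrier R" "u \<noteq> \<zero>" "u \<otimes> u = \<zero>"
  shows "\<not> atom R \<zero>"
proof
  assume "atom R \<zero>"
  then have "PIdl \<zero> = PIdl u" using assms unfolding atom_def by metis
  then have "u \<in> PIdl \<zero>" using assms cgenideal_self by simp
  then show False using assms by (auto simp: cgenideal_def)
qed

lemma no_atoms:
  assumes nil: "\<And>a. a \<in> carrier R \<Longrightarrow> a \<notin> Units R \<Longrightarrow> \<exists>n::nat. a [^] n = \<zero>"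
    and root: "\<And>a. a \<in> carrier R \<Longrightarrow> \<exists>g\<in>carrier R. a = g [^] p"
    and "(p::nat) \<ge> 2"
    and u: "u \<in> carrier R" "u \<noteq> \<zero>" "u \<otimes> u = \<zero>"
  shows "\<not> atom R a"
proof (cases "a = \<zero>")
  case True
  then show ?thesis using zero_not_atom u by simp
next
  case False
  show ?thesis
  proof
    assume atom: "atom R a"
    then have a: "a \<in> carrier R" "a \<notin> Units R" by (auto simp: atom_def)
    obtain n :: nat where n: "a [^] n = \<zero>" using nil a by blast
    obtain g where g: "g \<in> carrier R" "a = g [^] p" using root a by blast
    then have "g [^] (p * n) = \<zero>" using n by (simp add: nat_pow_pow)
    then show False using proper_power_not_atom[of g p] g False atom \<open>p \<ge> 2\<close> by blast
  qed
qed

text \<open>A nonzero element of square zero serves here as the nonzero nonunit without a factorization.\<close>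

lemma not_atomic_if_no_atoms:
  assumes "\<And>a. \<not> atom R a" and u: "u \<in> carrier R" "u \<noteq> \<zero>" "u \<otimes> u = \<zero>"
  shows "\<not> atomic_ring R"
proof
  have "u \<notin> Units R"
  proof
    assume "u \<in> Units R"
    then have "u = \<zero>" using u by (metis Units_l_cancel r_null zero_closed)
    then show False using u by simp
  qed
  moreover assume "atomic_ring R"
  ultimately obtain as where as: "\<forall>x\<in>set as. atom R x" "u = foldr (\<otimes>) as \<one>"
    using u unfolding atomic_ring_def by blast
  then have "as = []" using assms(1) by (cases as) auto
  then show False using as \<open>u \<notin> Units R\<close> by simp
qed

end

section \<open>Scaling exponents\<close>

definition scale_exp :: "rat \<Rightarrow> (nat \<Rightarrow>\<^sub>0 rat) \<Rightarrow> (nat \<Rightarrow>\<^sub>0 rat)" where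
  "scale_exp r \<beta> = Poly_Mapping.map ((*) r) \<beta>"

lemma lookup_scale_exp [simp]:
  "Poly_Mapping.lookup (scale_exp r \<beta>) i = r * Poly_Mapping.lookup \<beta> i"
  by (simp add: scale_exp_def map.rep_eq when_def)

lemma single_power:
  "Poly_Mapping.single \<beta> c ^ n = Poly_Mapping.single (scale_exp (of_nat n) \<beta>) (c ^ n)"
  for c :: "'f::comm_semiring_1"
proof (induction n)
  case 0
  have "scale_exp 0 \<beta> = 0" by (rule poly_mapping_eqI) simp
  then show ?case by (simp add: single_one)
next
  case (Suc n)
  have "\<beta> + scale_exp (of_nat n) \<beta> = scale_exp (of_nat (Suc n)) \<beta>"
    by (rule poly_mapping_eqI) (simp add: lookup_add algebra_simps)
  then show ?case by (simp add: Suc mult_single)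
qed

lemma total_deg_superset:
  assumes "finite A" "Poly_Mapping.keys \<beta> \<subseteq> A"
  shows "total_deg \<beta> = (\<Sum>i\<in>A. Poly_Mapping.lookup \<beta> i)"
  unfolding total_deg_def using assms by (intro sum.mono_neutral_left) (auto simp: in_keys_iff)

lemma total_deg_add: "total_deg (\<alpha> + \<beta>) = total_deg \<alpha> + total_deg \<beta>"
proof -
  let ?A = "Poly_Mapping.keys \<alpha> \<union> Poly_Mapping.keys \<beta>"
  have "Poly_Mapping.keys (\<alpha> + \<beta>) \<subseteq> ?A" by (rule keys_add)
  then show ?thesis
    by (simp add: total_deg_superset[of ?A] lookup_add sum.distrib)
qed

lemma total_deg_scale_exp: "total_deg (scale_exp r \<beta>) = r * total_deg \<beta>"
proof -
  have "Poly_Mapping.keys (scale_exp r \<beta>) \<subseteq> Poly_Mapping.keys \<beta>" by (auto simp: in_keys_iff)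
  then show ?thesis
    by (simp add: total_deg_superset[of "Poly_Mapping.keys \<beta>"] sum_distrib_left)
qed

lemma total_deg_nonneg: "\<beta> \<in> nonneg_exps \<Longrightarrow> total_deg \<beta> \<ge> 0"
  by (auto simp: total_deg_def nonneg_exps_def intro: sum_nonneg)

lemma total_deg_pos: "\<beta> \<in> nonneg_exps \<Longrightarrow> \<beta> \<noteq> 0 \<Longrightarrow> total_deg \<beta> > 0"
  unfolding total_deg_def
  by (rule sum_pos) (auto simp: nonneg_exps_def in_keys_iff order.strict_iff_order)

section \<open>The algebra \<open>T\<close> and its ideal \<open>I\<close>\<close>

lemma T_ring_simps [simp]:
  "carrier T_ring = {f. Poly_Mapping.keys f \<subseteq> nonneg_exps}"
  "x \<otimes>\<^bsub>T_ring\<^esub> y = x * y" "x \<oplus>\<^bsub>T_ring\<^esub> y = x + y" "\<one>\<^bsub>T_ring\<^esub> = 1" "\<zero>\<^bsub>T_ring\<^esub> = 0"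
  by (simp_all add: T_ring_def ring_of_type_algebra_def)

lemma T_ring_nat_pow [simp]: "x [^]\<^bsub>T_ring\<^esub> (n::nat) = x ^ n"
  by (induction n) (simp_all add: mult.commute nat_pow_def)

lemma T_ring_a_inv:
  fixes x :: "(nat \<Rightarrow>\<^sub>0 rat) \<Rightarrow>\<^sub>0 'f::field"
  assumes "x \<in> carrier T_ring"
  shows "\<ominus>\<^bsub>T_ring\<^esub> x = - x"
proof -
  interpret T: cring "T_ring :: ((nat \<Rightarrow>\<^sub>0 rat) \<Rightarrow>\<^sub>0 'f) ring" by (rule cring_T_ring)
  have "Poly_Mapping.keys (- x) = Poly_Mapping.keys x" by (auto simp: in_keys_iff)
  then show ?thesis using assms by (intro T.minus_equality) auto
qed

lemma monomial_in_T_ring: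
  "\<beta> \<in> nonneg_exps \<Longrightarrow> Poly_Mapping.single \<beta> c \<in> carrier T_ring"
  by simp

lemma T_ring_sum_closed:
  "(\<And>i. i \<in> A \<Longrightarrow> f i \<in> carrier T_ring) \<Longrightarrow> sum f A \<in> carrier T_ring"
  using keys_sum[of f A] by fastforce

lemma sum_monomials:
  "f = (\<Sum>\<beta>\<in>Poly_Mapping.keys f. Poly_Mapping.single \<beta> (Poly_Mapping.lookup f \<beta>))"
  by (rule poly_mapping_eqI)
     (simp add: lookup_sum lookup_single when_def in_keys_iff sum.delta)

text \<open>
  The generators of \<open>I\<close> are monomials, so membership can be tested monomial by monomial; this is how
  elements are shown to lie outside \<open>I\<close>.
\<close>

lemma I_ideal_eq:
  "(I_ideal :: ((nat \<Rightarrow>\<^sub>0 rat) \<Rightarrow>\<^sub>0 'f::field) set) =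
     {f. \<forall>\<beta>\<in>Poly_Mapping.keys f. \<beta> \<in> nonneg_exps \<and> total_deg \<beta> > 1}" (is "_ = ?J")
proof
  interpret T: cring "T_ring :: ((nat \<Rightarrow>\<^sub>0 rat) \<Rightarrow>\<^sub>0 'f) ring" by (rule cring_T_ring)
  have mult: "x * a \<in> ?J" if "a \<in> ?J" "x \<in> carrier T_ring" for a x :: "(nat \<Rightarrow>\<^sub>0 rat) \<Rightarrow>\<^sub>0 'f"
  proof -
    have "\<beta> \<in> nonneg_exps \<and> total_deg \<beta> > 1" if "\<beta> \<in> Poly_Mapping.keys (x * a)" for \<beta>
    proof -
      obtain s t where st: "s \<in> Poly_Mapping.keys x" "t \<in> Poly_Mapping.keys a" "\<beta> = s + t"
        using keys_mult[of x a] \<open>\<beta> \<in> _\<close> by blast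
      then have "s \<in> nonneg_exps" "t \<in> nonneg_exps" "total_deg t > 1"
        using \<open>a \<in> ?J\<close> \<open>x \<in> carrier T_ring\<close> by auto
      moreover from this have "total_deg s \<ge> 0" by (simp add: total_deg_nonneg)
      ultimately show ?thesis
        using st by (auto simp: nonneg_exps_def lookup_add total_deg_add)
    qed
    then show ?thesis by blast
  qed
  have uminus: "Poly_Mapping.keys (- x) = Poly_Mapping.keys x" for x :: "(nat \<Rightarrow>\<^sub>0 rat) \<Rightarrow>\<^sub>0 'f"
    by (auto simp: in_keys_iff)
  have "subgroup ?J (add_monoid T_ring)"
  proof (rule group.subgroupI[OF T.a_group])
    show "?J \<subseteq> carrier (add_monoid T_ring)" by auto
    show "?J \<noteq> {}" by (auto intro: exI[of _ 0])
  next
    fix a assume "a \<in> ?J"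
    moreover from this have "a \<in> carrier T_ring" by auto
    ultimately show "inv\<^bsub>add_monoid T_ring\<^esub> a \<in> ?J"
      using T_ring_a_inv[of a] uminus[of a] by (simp add: a_inv_def)
  next
    fix a b assume "a \<in> ?J" "b \<in> ?J"
    then show "a \<otimes>\<^bsub>add_monoid T_ring\<^esub> b \<in> ?J"
      using keys_add[of a b] by auto
  qed
  then have "ideal ?J T_ring"
  proof (rule idealI[OF T.ring_axioms])
    fix a x :: "(nat \<Rightarrow>\<^sub>0 rat) \<Rightarrow>\<^sub>0 'f" assume "a \<in> ?J" "x \<in> carrier T_ring"
    then have "x * a \<in> ?J" by (rule mult)
    then show "x \<otimes>\<^bsub>T_ring\<^esub> a \<in> ?J" "a \<otimes>\<^bsub>T_ring\<^esub> x \<in> ?J"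
      by (simp_all only: T_ring_simps mult.commute[of a x])
  qed
  then show "I_ideal \<subseteq> ?J"
    unfolding I_ideal_def by (rule T.genideal_minimal) auto
next
  interpret I: ideal "I_ideal :: ((nat \<Rightarrow>\<^sub>0 rat) \<Rightarrow>\<^sub>0 'f) set" T_ring by (rule ideal_I_ideal)
  show "?J \<subseteq> I_ideal"
  proof
    fix f :: "(nat \<Rightarrow>\<^sub>0 rat) \<Rightarrow>\<^sub>0 'f" assume f: "f \<in> ?J"
    have mono: "Poly_Mapping.single \<beta> c \<in> I_ideal"
      if "\<beta> \<in> nonneg_exps" "total_deg \<beta> > 1" for \<beta> and c :: 'f
    proof -
      have "Poly_Mapping.single \<beta> (1::'f) \<in> I_ideal"
        unfolding I_ideal_def using that by (intro I.genideal_self[THEN subsetD]) auto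
      then have "Poly_Mapping.single 0 c \<otimes>\<^bsub>T_ring\<^esub> Poly_Mapping.single \<beta> 1 \<in> I_ideal"
        by (rule I.I_l_closed) (simp add: nonneg_exps_def)
      then show ?thesis by (simp add: mult_single)
    qed
    have sum: "sum g A \<in> I_ideal" if "\<And>i. i \<in> A \<Longrightarrow> g i \<in> I_ideal"
      for g :: "(nat \<Rightarrow>\<^sub>0 rat) \<Rightarrow> (nat \<Rightarrow>\<^sub>0 rat) \<Rightarrow>\<^sub>0 'f" and A
      using that
    proof (induction A rule: infinite_finite_induct)
      case (insert x F)
      then show ?case using additive_subgroup.a_closed[OF I.is_additive_subgroup, of "g x" "sum g F"] by simp
    qed (use additive_subgroup.zero_closed[OF I.is_additive_subgroup] in simp_all)
    show "f \<in> I_ideal"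
      by (subst sum_monomials, rule sum, rule mono) (use f in auto)
  qed
qed

section \<open>Frobenius on \<open>T\<close>\<close>

lemma CHAR_monoid_algebra:
  "CHAR((nat \<Rightarrow>\<^sub>0 rat) \<Rightarrow>\<^sub>0 'f::comm_semiring_1) = CHAR('f)"
proof (rule CHAR_eqI)
  have of_nat_eq_0: "of_nat n = (0 :: (nat \<Rightarrow>\<^sub>0 rat) \<Rightarrow>\<^sub>0 'f) \<longleftrightarrow> of_nat n = (0::'f)" for n
  proof -
    have emb: "of_nat n = Poly_Mapping.single (0 :: nat \<Rightarrow>\<^sub>0 rat) (of_nat n :: 'f)"
      by (rule single_of_nat[symmetric])
    show ?thesis
    proof
      assume "of_nat n = (0 :: (nat \<Rightarrow>\<^sub>0 rat) \<Rightarrow>\<^sub>0 'f)"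
      then have "Poly_Mapping.lookup (Poly_Mapping.single (0 :: nat \<Rightarrow>\<^sub>0 rat) (of_nat n :: 'f)) 0 = 0"
        using emb by (simp only: lookup_zero)
      then show "of_nat n = (0::'f)" by (simp only: lookup_single_eq)
    next
      assume "of_nat n = (0::'f)"
      then show "of_nat n = (0 :: (nat \<Rightarrow>\<^sub>0 rat) \<Rightarrow>\<^sub>0 'f)" by (subst emb) (simp only: single_zero)
    qed
  qed
  show "of_nat CHAR('f) = (0 :: (nat \<Rightarrow>\<^sub>0 rat) \<Rightarrow>\<^sub>0 'f)" by (simp add: of_nat_eq_0)
  show "CHAR('f) dvd n" if "of_nat n = (0 :: (nat \<Rightarrow>\<^sub>0 rat) \<Rightarrow>\<^sub>0 'f)" for n
    using that by (simp add: of_nat_eq_0 of_nat_eq_0_iff_char_dvd)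
qed

lemma T_ring_pth_root:
  fixes f :: "(nat \<Rightarrow>\<^sub>0 rat) \<Rightarrow>\<^sub>0 'f::field"
  assumes p: "Factorial_Ring.prime CHAR('f)" and perf: "perfect_field TYPE('f)"
    and f: "f \<in> carrier T_ring"
  shows "\<exists>g\<in>carrier T_ring. f = g ^ CHAR('f)"
proof -
  let ?p = "CHAR('f)"
  have p0: "?p > 0" using p by (rule prime_gt_0_nat)
  obtain r :: "'f \<Rightarrow> 'f" where r: "r c ^ ?p = c" for c
    using perf p0 unfolding perfect_field_def by (metis less_irrefl)
  define h where
    "h \<beta> = Poly_Mapping.single (scale_exp (1 / of_nat ?p) \<beta>) (r (Poly_Mapping.lookup f \<beta>))" for \<beta>
  have h_pow: "h \<beta> ^ ?p = Poly_Mapping.single \<beta> (Poly_Mapping.lookup f \<beta>)" for \<beta>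
  proof -
    have "scale_exp (of_nat ?p) (scale_exp (1 / of_nat ?p) \<beta>) = \<beta>"
      using p0 by (intro poly_mapping_eqI) simp
    then show ?thesis by (simp add: h_def single_power r)
  qed
  have "(\<Sum>\<beta>\<in>Poly_Mapping.keys f. h \<beta>) ^ ?p = (\<Sum>\<beta>\<in>Poly_Mapping.keys f. h \<beta> ^ ?p)"
    by (rule freshmans_dream_sum) (simp_all add: p CHAR_monoid_algebra)
  also have "\<dots> = f" using sum_monomials[of f] by (simp add: h_pow)
  finally have "f = (\<Sum>\<beta>\<in>Poly_Mapping.keys f. h \<beta>) ^ ?p" by simp
  moreover have "(\<Sum>\<beta>\<in>Poly_Mapping.keys f. h \<beta>) \<in> carrier T_ring"
  proof (rule T_ring_sum_closed)
    fix \<beta> assume "\<beta> \<in> Poly_Mapping.keys f"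
    then have "\<beta> \<in> nonneg_exps" using f by auto
    then show "h \<beta> \<in> carrier T_ring"
      unfolding h_def by (intro monomial_in_T_ring) (simp add: nonneg_exps_def)
  qed
  ultimately show ?thesis by blast
qed

text \<open>
  The finitely many nonconstant monomials of \<open>f\<close> have degrees bounded below by some positive number,
  so a single power of \<open>p\<close> pushes all of them beyond degree \<open>1\<close>.
\<close>

lemma frobenius_power_mod_I:
  fixes f :: "(nat \<Rightarrow>\<^sub>0 rat) \<Rightarrow>\<^sub>0 'f::field"
  assumes p: "Factorial_Ring.prime CHAR('f)" and f: "f \<in> carrier T_ring"
  shows "\<exists>q>0. f ^ q - Poly_Mapping.single 0 (Poly_Mapping.lookup f 0 ^ q) \<in> I_ideal"
proof -
  let ?K = "Poly_Mapping.keys f - {0}"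
  have "\<exists>N::nat. \<forall>\<beta>\<in>A. of_nat N * total_deg \<beta> > 1" if "finite A" "A \<subseteq> ?K" for A
    using that
  proof (induction A rule: finite_induct)
    case (insert \<beta> A)
    then obtain N :: nat where N: "\<forall>\<beta>\<in>A. of_nat N * total_deg \<beta> > 1" by auto
    have pos: "total_deg \<alpha> > 0" if "\<alpha> \<in> insert \<beta> A" for \<alpha>
      using insert.prems that f by (intro total_deg_pos) auto
    then obtain M :: nat where M: "1 < of_nat M * total_deg \<beta>"
      using ex_less_of_nat_mult by blast
    have "of_nat (max N M) * total_deg \<alpha> > 1" if "\<alpha> \<in> insert \<beta> A" for \<alpha>
    proof -
      have "of_nat N * total_deg \<alpha> \<le> of_nat (max N M) * total_deg \<alpha>"
        "of_nat M * total_deg \<alpha> \<le> of_nat (max N M) * total_deg \<alpha>"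
        using pos[OF that] by (auto intro!: mult_right_mono)
      then show ?thesis using that N M by force
    qed
    then show ?case by blast
  qed auto
  then obtain N :: nat where N: "\<And>\<beta>. \<beta> \<in> ?K \<Longrightarrow> of_nat N * total_deg \<beta> > 1"
    by (metis finite_Diff finite_keys order_refl)
  \<comment> \<open>The exponent must be a power of the characteristic for Frobenius; \<open>p\<^sup>N\<close> exceeds the bound \<open>N\<close>.\<close>
  define q where "q = CHAR('f) ^ N"
  have "N < q" unfolding q_def using p by (intro power_gt_expt) (auto dest: prime_gt_1_nat)
  define c where "c \<beta> = Poly_Mapping.lookup f \<beta>" for \<beta>
  define g where "g = (\<Sum>\<beta>\<in>?K. Poly_Mapping.single (scale_exp (of_nat q) \<beta>) (c \<beta> ^ q))"
  have "f = (\<Sum>\<beta>\<in>insert 0 ?K. Poly_Mapping.single \<beta> (c \<beta>))"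
    unfolding c_def by (subst sum_monomials, rule sum.mono_neutral_left) (auto simp: in_keys_iff)
  then have "f ^ q = (\<Sum>\<beta>\<in>insert 0 ?K. Poly_Mapping.single \<beta> (c \<beta>) ^ q)"
    using freshmans_dream_sum'[of q N "\<lambda>\<beta>. Poly_Mapping.single \<beta> (c \<beta>)" "insert 0 ?K"] p
    by (simp add: CHAR_monoid_algebra q_def)
  also have "\<dots> = Poly_Mapping.single 0 (c 0) ^ q + g"
    unfolding g_def by (subst sum.insert) (simp_all add: single_power)
  also have "Poly_Mapping.single 0 (c 0) ^ q = Poly_Mapping.single (0 :: nat \<Rightarrow>\<^sub>0 rat) (c 0 ^ q)"
  proof -
    have "scale_exp (of_nat q) 0 = 0" by (rule poly_mapping_eqI) simp
    then show ?thesis by (simp add: single_power)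
  qed
  finally have "f ^ q - Poly_Mapping.single 0 (c 0 ^ q) = g" by simp
  moreover have "g \<in> I_ideal"
    unfolding I_ideal_eq
  proof safe
    fix \<gamma> assume "\<gamma> \<in> Poly_Mapping.keys g"
    then obtain \<beta> where \<beta>: "\<beta> \<in> ?K" "\<gamma> = scale_exp (of_nat q) \<beta>"
      unfolding g_def using keys_sum by (fastforce split: if_splits)
    have nn: "\<beta> \<in> nonneg_exps" using \<beta> f by auto
    then show "\<gamma> \<in> nonneg_exps" by (simp add: \<beta> nonneg_exps_def)
    have "of_nat N * total_deg \<beta> \<le> of_nat q * total_deg \<beta>"
      using \<open>N < q\<close> nn by (intro mult_right_mono) (auto simp: total_deg_nonneg)
    then show "total_deg \<gamma> > 1" using N[of \<beta>] \<beta> by (simp add: total_deg_scale_exp)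
  qed
  ultimately show ?thesis using \<open>N < q\<close> unfolding c_def by (intro exI[of _ q]) auto
qed

section \<open>The quotient \<open>R\<close>\<close>

abbreviation R_class :: "((nat \<Rightarrow>\<^sub>0 rat) \<Rightarrow>\<^sub>0 'f::field) \<Rightarrow> ((nat \<Rightarrow>\<^sub>0 rat) \<Rightarrow>\<^sub>0 'f) set" where
  "R_class f \<equiv> I_ideal +>\<^bsub>T_ring\<^esub> f"

lemma R_class_hom: "ring_hom_cring T_ring R_ring R_class"
  unfolding R_ring_def by (rule ideal.rcos_ring_hom_cring[OF ideal_I_ideal cring_T_ring])

lemma R_class_surj:
  assumes "a \<in> carrier R_ring"
  obtains f where "f \<in> carrier T_ring" "a = R_class f"
  using assms unfolding R_ring_def FactRing_def A_RCOSETS_def' by auto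

lemma R_class_eq_zero_iff:
  fixes f :: "(nat \<Rightarrow>\<^sub>0 rat) \<Rightarrow>\<^sub>0 'f::field"
  assumes "f \<in> carrier T_ring"
  shows "R_class f = \<zero>\<^bsub>R_ring\<^esub> \<longleftrightarrow> f \<in> I_ideal"
proof -
  interpret I: ideal "I_ideal :: ((nat \<Rightarrow>\<^sub>0 rat) \<Rightarrow>\<^sub>0 'f) set" T_ring by (rule ideal_I_ideal)
  have "\<zero>\<^bsub>R_ring\<^esub> = (I_ideal :: ((nat \<Rightarrow>\<^sub>0 rat) \<Rightarrow>\<^sub>0 'f) set)" by (simp add: R_ring_def FactRing_def)
  then show ?thesis
    using I.a_rcos_self[OF assms] I.a_rcos_const[of f] by metis
qed

lemma R_class_nat_pow:
  fixes f :: "(nat \<Rightarrow>\<^sub>0 rat) \<Rightarrow>\<^sub>0 'f::field"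
  assumes "f \<in> carrier T_ring"
  shows "R_class (f ^ n) = R_class f [^]\<^bsub>R_ring\<^esub> n"
  using ring_hom_ring.hom_nat_pow[OF ideal.rcos_ring_hom_ring[OF ideal_I_ideal] assms, of n]
  by (simp add: R_ring_def)

text \<open>
  For the class \<open>a\<close> of \<open>f\<close>, some power \<open>a\<^sup>q\<close> is the class of the constant \<open>c\<^sup>q\<close>, where \<open>c\<close> is the
  constant term of \<open>f\<close>.  If \<open>c \<noteq> 0\<close>, then \<open>a\<close> divides a unit; otherwise \<open>a\<^sup>q = 0\<close>.
\<close>

lemma nonunit_nilpotent_R_ring:
  fixes a :: "((nat \<Rightarrow>\<^sub>0 rat) \<Rightarrow>\<^sub>0 'f::field) set"
  assumes p: "Factorial_Ring.prime CHAR('f)"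
    and a: "a \<in> carrier R_ring" "a \<notin> Units R_ring"
  shows "\<exists>n::nat. a [^]\<^bsub>R_ring\<^esub> n = \<zero>\<^bsub>R_ring\<^esub>"
proof -
  interpret h: ring_hom_cring "T_ring :: ((nat \<Rightarrow>\<^sub>0 rat) \<Rightarrow>\<^sub>0 'f) ring" R_ring R_class
    by (rule R_class_hom)
  obtain f where f: "f \<in> carrier T_ring" "a = R_class f" using a by (auto elim: R_class_surj)
  define c where "c = Poly_Mapping.lookup f 0"
  obtain q where q: "q > 0" and I: "f ^ q - Poly_Mapping.single 0 (c ^ q) \<in> I_ideal"
    using frobenius_power_mod_I[OF p f(1)] unfolding c_def by blast
  have const: "Poly_Mapping.single 0 d \<in> carrier T_ring" for d :: 'f
    by (simp add: nonneg_exps_def)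
  have IT: "f ^ q - Poly_Mapping.single 0 (c ^ q) \<in> carrier T_ring"
    using I by (auto simp: I_ideal_eq)
  have "R_class (f ^ q) =
      R_class (f ^ q - Poly_Mapping.single 0 (c ^ q)) \<oplus>\<^bsub>R_ring\<^esub> R_class (Poly_Mapping.single 0 (c ^ q))"
    using h.hom_add[OF IT const[of "c ^ q"]] by simp
  then have aq: "a [^]\<^bsub>R_ring\<^esub> q = R_class (Poly_Mapping.single 0 (c ^ q))"
    using I IT R_class_eq_zero_iff[OF IT] h.hom_closed[OF const[of "c ^ q"]]
    by (simp add: f R_class_nat_pow[OF f(1)])
  have "c = 0"
  proof (rule ccontr)
    assume "c \<noteq> 0"
    let ?d = "R_class (Poly_Mapping.single 0 (inverse c ^ q))"
    have "a [^]\<^bsub>R_ring\<^esub> q \<otimes>\<^bsub>R_ring\<^esub> ?d =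
        R_class (Poly_Mapping.single 0 (c ^ q) * Poly_Mapping.single 0 (inverse c ^ q))"
      using h.hom_mult[OF const[of "c ^ q"] const[of "inverse c ^ q"]] by (simp add: aq)
    also have "\<dots> = \<one>\<^bsub>R_ring\<^esub>"
      using \<open>c \<noteq> 0\<close> h.hom_one by (simp add: mult_single flip: power_mult_distrib)
    finally have one: "a [^]\<^bsub>R_ring\<^esub> q \<otimes>\<^bsub>R_ring\<^esub> ?d = \<one>\<^bsub>R_ring\<^esub>" .
    obtain m where m: "q = Suc m" using q by (cases q) auto
    have d: "?d \<in> carrier R_ring" by (rule h.hom_closed[OF const])
    have "a \<otimes>\<^bsub>R_ring\<^esub> (a [^]\<^bsub>R_ring\<^esub> m \<otimes>\<^bsub>R_ring\<^esub> ?d) = \<one>\<^bsub>R_ring\<^esub>"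
      using one a d unfolding m
      by (simp only: h.S.nat_pow_Suc2 h.S.m_assoc h.S.nat_pow_closed)
    then have "a \<in> Units R_ring"
      using a d by (metis h.S.Units_one_closed h.S.unit_factor h.S.m_closed h.S.nat_pow_closed)
    then show False using a by simp
  qed
  then have "a [^]\<^bsub>R_ring\<^esub> q = \<zero>\<^bsub>R_ring\<^esub>"
    using aq q h.hom_zero by (simp add: power_0_left)
  then show ?thesis by blast
qed

lemma R_ring_pth_root:
  fixes a :: "((nat \<Rightarrow>\<^sub>0 rat) \<Rightarrow>\<^sub>0 'f::field) set"
  assumes "Factorial_Ring.prime CHAR('f)" "perfect_field TYPE('f)" "a \<in> carrier R_ring"
  shows "\<exists>g\<in>carrier R_ring. a = g [^]\<^bsub>R_ring\<^esub> CHAR('f)"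
proof -
  interpret h: ring_hom_cring "T_ring :: ((nat \<Rightarrow>\<^sub>0 rat) \<Rightarrow>\<^sub>0 'f) ring" R_ring R_class
    by (rule R_class_hom)
  obtain f where f: "f \<in> carrier T_ring" "a = R_class f" using assms by (auto elim: R_class_surj)
  obtain g where g: "g \<in> carrier T_ring" "f = g ^ CHAR('f)" using T_ring_pth_root assms f by blast
  have "a = R_class g [^]\<^bsub>R_ring\<^esub> CHAR('f)" using f g R_class_nat_pow by metis
  then show ?thesis using g h.hom_closed by blast
qed

text \<open>The class of \<open>x\<^sub>1\<^sup>2\<^sup>/\<^sup>3\<close>: the degree \<open>2/3\<close> is at most \<open>1\<close>, but its double is not.\<close>

lemma R_ring_square_zero:
  "\<exists>u\<in>carrier (R_ring :: ((nat \<Rightarrow>\<^sub>0 rat) \<Rightarrow>\<^sub>0 'f::field) set ring).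
     u \<noteq> \<zero>\<^bsub>R_ring\<^esub> \<and> u \<otimes>\<^bsub>R_ring\<^esub> u = \<zero>\<^bsub>R_ring\<^esub>"
proof -
  interpret h: ring_hom_cring "T_ring :: ((nat \<Rightarrow>\<^sub>0 rat) \<Rightarrow>\<^sub>0 'f) ring" R_ring R_class
    by (rule R_class_hom)
  define \<beta> :: "nat \<Rightarrow>\<^sub>0 rat" where "\<beta> = Poly_Mapping.single 0 (2/3)"
  define x :: "(nat \<Rightarrow>\<^sub>0 rat) \<Rightarrow>\<^sub>0 'f" where "x = Poly_Mapping.single \<beta> 1"
  have nn: "\<beta> \<in> nonneg_exps" "\<beta> + \<beta> \<in> nonneg_exps"
    unfolding nonneg_exps_def mem_Collect_eq lookup_add \<beta>_def lookup_single when_def by auto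
  have deg: "total_deg \<beta> = 2/3" "total_deg (\<beta> + \<beta>) > 1"
    unfolding total_deg_add by (simp_all add: \<beta>_def total_deg_def)
  have x: "x \<in> carrier T_ring" unfolding x_def using nn by (intro monomial_in_T_ring)
  have xx: "x * x = Poly_Mapping.single (\<beta> + \<beta>) 1" by (simp add: x_def mult_single)
  then have "x * x \<in> carrier T_ring" using nn by (simp add: monomial_in_T_ring)
  moreover have "x * x \<in> I_ideal" using nn deg unfolding xx I_ideal_eq by auto
  moreover have "x \<notin> I_ideal" by (simp add: x_def I_ideal_eq deg)
  ultimately have "R_class x \<noteq> \<zero>\<^bsub>R_ring\<^esub>" "R_class x \<otimes>\<^bsub>R_ring\<^esub> R_class x = \<zero>\<^bsub>R_ring\<^esub>"
    using x R_class_eq_zero_iff h.hom_mult[OF x x] by (metis, metis T_ring_simps(2))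
  then show ?thesis using h.hom_closed[OF x] by blast
qed

theorem proposition2p2:
  fixes p :: nat
  assumes "Factorial_Ring.prime p"
    and "CHAR('f::field) = p"
    and "perfect_field TYPE('f)"
  shows "(\<forall>a. \<not> atom (R_ring :: ((nat \<Rightarrow>\<^sub>0 rat) \<Rightarrow>\<^sub>0 'f) set ring) a) \<and>
    \<not> atomic_ring (R_ring :: ((nat \<Rightarrow>\<^sub>0 rat) \<Rightarrow>\<^sub>0 'f) set ring)"
proof -
  interpret R: cring "R_ring :: ((nat \<Rightarrow>\<^sub>0 rat) \<Rightarrow>\<^sub>0 'f) set ring" by (rule cring_R_ring)
  have p: "Factorial_Ring.prime CHAR('f)" using assms by simp
  obtain u where u: "u \<in> carrier (R_ring :: ((nat \<Rightarrow>\<^sub>0 rat) \<Rightarrow>\<^sub>0 'f) set ring)"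
    "u \<noteq> \<zero>\<^bsub>R_ring\<^esub>" "u \<otimes>\<^bsub>R_ring\<^esub> u = \<zero>\<^bsub>R_ring\<^esub>"
    using R_ring_square_zero by blast
  have "\<not> atom (R_ring :: ((nat \<Rightarrow>\<^sub>0 rat) \<Rightarrow>\<^sub>0 'f) set ring) a" for a
    using nonunit_nilpotent_R_ring[OF p] R_ring_pth_root[OF p assms(3)] prime_ge_2_nat[OF p] u
    by (rule R.no_atoms)
  then show ?thesis using R.not_atomic_if_no_atoms u by blast
qed

end
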